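(* Let $\mathbb{K}$ be a complete non-Archimedean valued field, let $\mathcal{X}$ be a p-adic Hilbert space over $\mathbb{K}$, and let $f(z):=a_0+a_1z+\cdots+a_Nz^N\in\mathbb{K}[z]$ be a polynomial of degree $N$ over $\mathbb{K}$ (with $N\geq 1$). Let $T:\mathcal{X}\to\mathcal{X}$ be a magic contraction, and let $U:\oplus_{k=1}^{N+1}\mathcal{X}\to\oplus_{k=1}^{N+1}\mathcal{X}$ be any Egervary N-dilation of $T$. Then $$\|f(T)\|\le\|f(U)\|,$$ where $\|\cdot\|$ denotes the operator norm.
   Context: p-adic Hilbert space: Let $\mathbb{K}$ be a complete non-Archimedean valued field with valuation $|\cdot|$, and let $\mathcal{X}$ be a non-Archimedean Banach space over $\mathbb{K}$ with norm $\|\cdot\|$. $\mathcal{X}$ is a p-adic Hilbert space if there is a map (inner product) $\langle\cdot,\cdot\rangle:\mathcal{X}\times\mathcal{X}\to\mathbb{K}$ such that (i) if $\langle x,y\rangle=0$ for all $y\in\mathcal{X}$ then $x=0$; (ii) $\langle x,y\rangle=\langle y,x\rangle$ for all $x,y$; (iii) $\langle\alpha x+y,z\rangle=\alpha\langle x,z\rangle+\langle y,z\rangle$ for all $\alpha\in\mathbb{K}$ and $x,y,z\in\mathcal{X}$; (iv) $|\langle x,y\rangle|\le\|x\|\|y\|$ for all $x,y$. Operators: a bounded linear operator $T:\mathcal{X}\to\mathcal{X}$ is adjointable if there is a bounded linear operator $T^*:\mathcal{X}\to\mathcal{X}$ with $\langle Tx,y\rangle=\langle x,T^*y\rangle$ for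 all $x,y\in\mathcal{X}$ (it is then unique). An adjointable $T$ is self-adjoint if $T^*=T$. $I_\mathcal{X}$ is the identity operator on $\mathcal{X}$. Magic contraction: a bounded linear adjointable operator $T:\mathcal{X}\to\mathcal{X}$ is a magic contraction if there are self-adjoint bounded linear operators $M_T, M_{T^*}:\mathcal{X}\to\mathcal{X}$ (not necessarily unique) such that $M_T^2=I_\mathcal{X}-T^*T$, $M_{T^*}^2=I_\mathcal{X}-TT^*$ and $TM_T=M_{T^*}T$. The direct sum $\oplus_{k=1}^{N+1}\mathcal{X}$ carries the norm $\|(x_k)_k\|=\max_k\|x_k\|$ and inner product $\langle(x_k)_k,(y_k)_k\rangle=\sum_{k=1}^{N+1}\langle x_k,y_k\rangle$. Egervary N-dilation: for a magic contraction $T$ and a choice of operators $M_T,M_{T^*}$ as in the definition of magic contraction, the corresponding Egervary N-dilation of $T$ is the operator $U$ on $\oplus_{k=1}^{N+1}\mathcal{X}$ given by $$U(x_1,\dots,x_{N+1})=(Tx_1+M_{T^*}x_{N+1},\ M_Tx_1-T^*x_{N+1},\ x_2,\ x_3,\dots,x_N).$$ For a bounded linear operator $A$ on a space $\mathcal{Y}$, $f(A):=a_0I_\mathcal{Y}+a_1A+\cdots+a_NA^N$. *)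

theory Defs
  imports
    "HOL-Analysis.Abstract_Metric_Spaces"
    "HOL-Computational_Algebra.Polynomial"
    "HOL-Library.Function_Algebras"
begin

text \<open>
  The norms of the type classes \<open>real_normed_vector\<close> and \<open>real_normed_field\<close> are tied to the
  archimedean absolute value of the reals, so valuations and norms are explicit parameters here:
  \<open>v\<close> is the valuation of the scalar field, \<open>smul\<close> the scalar multiplication, \<open>nrm\<close> the norm
  and \<open>ip\<close> the inner product. The trivial valuation is allowed.
\<close>

locale complete_nonarch_field =
  fixes v :: "'k::field \<Rightarrow> real"
  assumes v_nonneg: "v a \<ge> 0"
    and v_eq_0_iff: "v a = 0 \<longleftrightarrow> a = 0"
    and v_mult: "v (a * b) = v a * v b"
    and v_ultrametric: "v (a + b) \<le> max (v a) (v b)"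
    and v_complete: "Metric_space.mcomplete UNIV (\<lambda>a b. v (a - b))"

locale nonarch_banach_space = complete_nonarch_field v + vector_space smul
  for v :: "'k::field \<Rightarrow> real"
    and smul :: "'k \<Rightarrow> 'x::ab_group_add \<Rightarrow> 'x" +
  fixes nrm :: "'x \<Rightarrow> real"
  assumes nrm_nonneg: "nrm x \<ge> 0"
    and nrm_eq_0_iff: "nrm x = 0 \<longleftrightarrow> x = 0"
    and nrm_scale: "nrm (smul a x) = v a * nrm x"
    and nrm_ultrametric: "nrm (x + y) \<le> max (nrm x) (nrm y)"
    and nrm_complete: "Metric_space.mcomplete UNIV (\<lambda>x y. nrm (x - y))"

locale padic_hilbert_space = nonarch_banach_space v smul nrm
  for v :: "'k::field \<Rightarrow> real"
    and smul :: "'k \<Rightarrow> 'x::ab_group_add \<Rightarrow> 'x"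
    and nrm :: "'x \<Rightarrow> real" +
  fixes ip :: "'x \<Rightarrow> 'x \<Rightarrow> 'k"
  assumes ip_nondegenerate: "(\<And>y. ip x y = 0) \<Longrightarrow> x = 0"
    and ip_sym: "ip x y = ip y x"
    and ip_linear: "ip (smul a x + y) z = a * ip x z + ip y z"
    and ip_bounded: "v (ip x y) \<le> nrm x * nrm y"

definition bounded_op ::
  "('k::field \<Rightarrow> 'x::ab_group_add \<Rightarrow> 'x) \<Rightarrow> ('x \<Rightarrow> real) \<Rightarrow> ('x \<Rightarrow> 'x) \<Rightarrow> bool" where
  "bounded_op smul nrm T \<longleftrightarrow>
     Vector_Spaces.linear smul smul T \<and> (\<exists>C. \<forall>x. nrm (T x) \<le> C * nrm x)"

definition is_adjoint ::
  "('k::field \<Rightarrow> 'x::ab_group_add \<Rightarrow> 'x) \<Rightarrow> ('x \<Rightarrow> real) \<Rightarrow> ('x \<Rightarrow> 'x \<Rightarrow> 'k)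
    \<Rightarrow> ('x \<Rightarrow> 'x) \<Rightarrow> ('x \<Rightarrow> 'x) \<Rightarrow> bool" where
  "is_adjoint smul nrm ip T S \<longleftrightarrow> bounded_op smul nrm S \<and> (\<forall>x y. ip (T x) y = ip x (S y))"

definition adjointable ::
  "('k::field \<Rightarrow> 'x::ab_group_add \<Rightarrow> 'x) \<Rightarrow> ('x \<Rightarrow> real) \<Rightarrow> ('x \<Rightarrow> 'x \<Rightarrow> 'k)
    \<Rightarrow> ('x \<Rightarrow> 'x) \<Rightarrow> bool" where
  "adjointable smul nrm ip T \<longleftrightarrow> bounded_op smul nrm T \<and> (\<exists>S. is_adjoint smul nrm ip T S)"

definition adj ::
  "('k::field \<Rightarrow> 'x::ab_group_add \<Rightarrow> 'x) \<Rightarrow> ('x \<Rightarrow> real) \<Rightarrow> ('x \<Rightarrow> 'x \<Rightarrow> 'k)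
    \<Rightarrow> ('x \<Rightarrow> 'x) \<Rightarrow> 'x \<Rightarrow> 'x" where
  "adj smul nrm ip T = (THE S. is_adjoint smul nrm ip T S)"

definition self_adjoint ::
  "('k::field \<Rightarrow> 'x::ab_group_add \<Rightarrow> 'x) \<Rightarrow> ('x \<Rightarrow> real) \<Rightarrow> ('x \<Rightarrow> 'x \<Rightarrow> 'k)
    \<Rightarrow> ('x \<Rightarrow> 'x) \<Rightarrow> bool" where
  "self_adjoint smul nrm ip T \<longleftrightarrow> adjointable smul nrm ip T \<and> adj smul nrm ip T = T"

text \<open>
  The admissible choices \<open>M\<close>, \<open>M'\<close> of the operators written $M_T$, $M_{T^*}$ in the definition
  of a magic contraction.
\<close>

definition magic_pair ::
  "('k::field \<Rightarrow> 'x::ab_group_add \<Rightarrow> 'x) \<Rightarrow> ('x \<Rightarrow> real) \<Rightarrow> ('x \<Rightarrow> 'x \<Rightarrow> 'k)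
    \<Rightarrow> ('x \<Rightarrow> 'x) \<Rightarrow> ('x \<Rightarrow> 'x) \<Rightarrow> ('x \<Rightarrow> 'x) \<Rightarrow> bool" where
  "magic_pair smul nrm ip T M M' \<longleftrightarrow>
     self_adjoint smul nrm ip M \<and> self_adjoint smul nrm ip M' \<and>
     (\<forall>x. M (M x) = x - adj smul nrm ip T (T x)) \<and>
     (\<forall>x. M' (M' x) = x - T (adj smul nrm ip T x)) \<and>
     (\<forall>x. T (M x) = M' (T x))"

definition magic_contraction ::
  "('k::field \<Rightarrow> 'x::ab_group_add \<Rightarrow> 'x) \<Rightarrow> ('x \<Rightarrow> real) \<Rightarrow> ('x \<Rightarrow> 'x \<Rightarrow> 'k)
    \<Rightarrow> ('x \<Rightarrow> 'x) \<Rightarrow> bool" where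
  "magic_contraction smul nrm ip T \<longleftrightarrow>
     adjointable smul nrm ip T \<and> (\<exists>M M'. magic_pair smul nrm ip T M M')"

text \<open>
  The direct sum of \<open>m\<close> copies of a space is the set of functions vanishing outside \<open>{1..m}\<close>.
  The vector space structure is pointwise: addition is that of \<open>Function_Algebras\<close>,
  scalar multiplication is \<open>direct_sum_scale\<close>.
\<close>

definition direct_sum :: "nat \<Rightarrow> (nat \<Rightarrow> 'x::zero) set" where
  "direct_sum m = {x. \<forall>k. k \<notin> {1..m} \<longrightarrow> x k = 0}"

definition direct_sum_scale :: "('k \<Rightarrow> 'x \<Rightarrow> 'x) \<Rightarrow> 'k \<Rightarrow> (nat \<Rightarrow> 'x) \<Rightarrow> nat \<Rightarrow> 'x" where
  "direct_sum_scale smul a x = (\<lambda>k. smul a (x k))"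

definition direct_sum_norm :: "nat \<Rightarrow> ('x \<Rightarrow> real) \<Rightarrow> (nat \<Rightarrow> 'x) \<Rightarrow> real" where
  "direct_sum_norm m nrm x = Max ((\<lambda>k. nrm (x k)) ` {1..m})"

definition egervary_op ::
  "nat \<Rightarrow> ('x \<Rightarrow> 'x) \<Rightarrow> ('x \<Rightarrow> 'x) \<Rightarrow> ('x \<Rightarrow> 'x) \<Rightarrow> ('x \<Rightarrow> 'x)
    \<Rightarrow> (nat \<Rightarrow> 'x::ab_group_add) \<Rightarrow> nat \<Rightarrow> 'x" where
  "egervary_op N T Tstar M M' x =
     (\<lambda>k. if k = 1 then T (x 1) + M' (x (N + 1))
          else if k = 2 then M (x 1) - Tstar (x (N + 1))
          else if k \<in> {3..N + 1} then x (k - 1)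
          else 0)"

definition egervary_dilation ::
  "('k::field \<Rightarrow> 'x::ab_group_add \<Rightarrow> 'x) \<Rightarrow> ('x \<Rightarrow> real) \<Rightarrow> ('x \<Rightarrow> 'x \<Rightarrow> 'k)
    \<Rightarrow> nat \<Rightarrow> ('x \<Rightarrow> 'x) \<Rightarrow> ((nat \<Rightarrow> 'x) \<Rightarrow> nat \<Rightarrow> 'x) \<Rightarrow> bool" where
  "egervary_dilation smul nrm ip N T U \<longleftrightarrow>
     (\<exists>M M'. magic_pair smul nrm ip T M M' \<and>
       (\<forall>x \<in> direct_sum (N + 1). U x = egervary_op N T (adj smul nrm ip T) M M' x))"

definition poly_op ::
  "('k::field \<Rightarrow> 'y::ab_group_add \<Rightarrow> 'y) \<Rightarrow> 'k poly \<Rightarrow> ('y \<Rightarrow> 'y) \<Rightarrow> 'y \<Rightarrow> 'y" where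
  "poly_op smul f A y = (\<Sum>k\<le>degree f. smul (coeff f k) ((A ^^ k) y))"

text \<open>
  Operator norm on the subspace \<open>S\<close>. As in \<open>onorm\<close> from HOL-Analysis, the vector \<open>0\<close> contributes
  \<open>0 / 0 = 0\<close>, so the supremum is that over the nonzero vectors, and it is \<open>0\<close> if
  \<open>S = {0}\<close>. A supremum over the unit ball would be a different quantity in general, since
  vectors cannot always be rescaled to norm \<open>1\<close>.
\<close>

definition op_norm :: "'y set \<Rightarrow> ('y \<Rightarrow> real) \<Rightarrow> ('y \<Rightarrow> 'y) \<Rightarrow> real" where
  "op_norm S nrm A = (SUP y\<in>S. nrm (A y) / nrm y)"

lemma egervary_op_in_direct_sum: "N \<ge> 1 \<Longrightarrow> egervary_op N T Tstar M M' x \<in> direct_sum (N + 1)"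
  by (auto simp: direct_sum_def egervary_op_def)

end

theory Submission
  imports Defs
begin

text \<open>
  Starting from \<open>(x, 0, \<dots>, 0)\<close>, the last coordinate of \<open>U\<^sup>k (x, 0, \<dots>, 0)\<close> stays \<open>0\<close> for
  \<open>k < N\<close>, because the entries created in the second coordinate need \<open>N\<close> steps to travel to the
  end. Hence the first coordinate of \<open>U\<^sup>k (x, 0, \<dots>, 0)\<close> is \<open>T\<^sup>k x\<close> for all \<open>k \<le> N\<close>, and that of
  \<open>f(U) (x, 0, \<dots>, 0)\<close> is \<open>f(T) x\<close>. As \<open>(x, 0, \<dots>, 0)\<close> has the norm of \<open>x\<close>, each quotient in the
  norm of \<open>f(T)\<close> is bounded by one in the norm of \<open>f(U)\<close>. Since the norm is a real supremum, one
  also needs that \<open>f(U)\<close> is bounded.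
\<close>

lemma sum_fun_apply: "(\<Sum>i\<in>A. g i) k = (\<Sum>i\<in>A. g i k)"
  for g :: "'i \<Rightarrow> 'b \<Rightarrow> 'c::comm_monoid_add"
  by (induction A rule: infinite_finite_induct) auto

lemma poly_op_direct_sum_apply:
  "poly_op (direct_sum_scale smul) f A y k = (\<Sum>i\<le>degree f. smul (coeff f i) ((A ^^ i) y k))"
  by (simp add: poly_op_def sum_fun_apply direct_sum_scale_def)

lemma funpow_in_invariant_set:
  assumes "\<And>x. x \<in> S \<Longrightarrow> A x \<in> S" "x \<in> S"
  shows "(A ^^ i) x \<in> S"
  using assms by (induction i) auto

context nonarch_banach_space
begin

lemma nrm_0: "nrm 0 = 0"
  by (simp add: nrm_eq_0_iff)

text \<open>Multiplicativity gives \<open>v (- 1)\<close> square \<open>1\<close>, and nonnegativity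
  then leaves only the value \<open>1\<close>.\<close>

lemma nrm_minus: "nrm (- x) = nrm x"
proof -
  have "v 1 = 1"
    using v_mult[of 1 1] v_eq_0_iff[of 1] by simp
  then have "v (- 1) * v (- 1) = 1"
    using v_mult[of "- 1" "- 1"] by simp
  then have "v (- 1) = 1"
    using v_nonneg[of "- 1"] by (auto simp: square_eq_1_iff)
  then show ?thesis
    using nrm_scale[of "- 1" x] by simp
qed

text \<open>The ultrametric inequality is weakened on purpose: the estimates built on it only have
  to produce some finite bound, and sums suit linear arithmetic better than maxima.\<close>

lemma nrm_triangle: "nrm (x + y) \<le> nrm x + nrm y"
  using nrm_ultrametric[of x y] nrm_nonneg[of x] nrm_nonneg[of y] by linarith

lemma nrm_triangle_diff: "nrm (x - y) \<le> nrm x + nrm y"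
  using nrm_triangle[of x "- y"] by (simp add: nrm_minus)

lemma nrm_sum: "nrm (\<Sum>i\<in>A. g i) \<le> (\<Sum>i\<in>A. nrm (g i))"
proof (induction A rule: infinite_finite_induct)
  case (insert i A)
  then show ?case
    using nrm_triangle[of "g i" "\<Sum>i\<in>A. g i"] by simp
qed (simp_all add: nrm_0)

text \<open>\<open>bounded_op\<close> allows a negative constant, which can occur on the zero space;
  a nonnegative one is wanted for monotonicity of products.\<close>

lemma bounded_op_nonneg_bound:
  assumes "bounded_op smul nrm A"
  obtains C where "C \<ge> 0" "\<And>x. nrm (A x) \<le> C * nrm x"
proof -
  obtain C where C: "\<And>x. nrm (A x) \<le> C * nrm x"
    using assms by (auto simp: bounded_op_def)
  show thesis
  proof
    show "max C 0 \<ge> 0" by simp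
    show "nrm (A x) \<le> max C 0 * nrm x" for x
      using C[of x] mult_right_mono[OF max.cobounded1[of C 0] nrm_nonneg[of x]] by linarith
  qed
qed

lemma bounded_op_0:
  assumes "bounded_op smul nrm A"
  shows "A 0 = 0"
proof -
  obtain C where "nrm (A 0) \<le> C * nrm 0"
    using assms by (auto simp: bounded_op_def)
  then show ?thesis
    using nrm_nonneg[of "A 0"] by (simp add: nrm_0 flip: nrm_eq_0_iff)
qed

text \<open>The index is unrestricted: outside \<open>{1..m}\<close> the coordinate is
  \<open>0\<close>, and the maximum, taken over a nonempty range since \<open>m \<ge> 1\<close>, is
  nonnegative.\<close>

lemma direct_sum_norm_ge:
  assumes "x \<in> direct_sum m" "m \<ge> 1"
  shows "nrm (x k) \<le> direct_sum_norm m nrm x"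
proof -
  have in_range: "nrm (x j) \<le> direct_sum_norm m nrm x" if "j \<in> {1..m}" for j
    using that by (auto simp: direct_sum_norm_def intro!: Max_ge)
  show ?thesis
  proof (cases "k \<in> {1..m}")
    case False
    then have "nrm (x k) = 0"
      using assms by (simp add: direct_sum_def nrm_0)
    then show ?thesis
      using in_range[of 1] nrm_nonneg[of "x 1"] assms by auto
  qed (rule in_range)
qed

lemma direct_sum_norm_le:
  assumes "m \<ge> 1" "\<And>k. nrm (x k) \<le> B"
  shows "direct_sum_norm m nrm x \<le> B"
  using assms by (auto simp: direct_sum_norm_def)

lemma direct_sum_norm_nonneg:
  assumes "x \<in> direct_sum m" "m \<ge> 1"
  shows "direct_sum_norm m nrm x \<ge> 0"
  using direct_sum_norm_ge[OF assms] nrm_nonneg order_trans by blast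

lemma direct_sum_norm_single:
  assumes "m \<ge> 1"
  shows "direct_sum_norm m nrm (\<lambda>k. if k = 1 then x else 0) = nrm x"
proof (rule antisym)
  show "direct_sum_norm m nrm (\<lambda>k. if k = 1 then x else 0) \<le> nrm x"
    using assms by (intro direct_sum_norm_le) (auto simp: nrm_0 nrm_nonneg)
  show "nrm x \<le> direct_sum_norm m nrm (\<lambda>k. if k = 1 then x else 0)"
    using direct_sum_norm_ge[of "\<lambda>k. if k = 1 then x else 0" m 1] assms
    by (auto simp: direct_sum_def)
qed

lemma funpow_bound:
  assumes "m \<ge> 1" "C \<ge> 0" "\<And>x. x \<in> direct_sum m \<Longrightarrow> A x \<in> direct_sum m"
    and "\<And>x. x \<in> direct_sum m \<Longrightarrow> direct_sum_norm m nrm (A x) \<le> C * direct_sum_norm m nrm x"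
    and "x \<in> direct_sum m"
  shows "direct_sum_norm m nrm ((A ^^ i) x) \<le> C ^ i * direct_sum_norm m nrm x"
proof (induction i)
  case (Suc i)
  have "direct_sum_norm m nrm (A ((A ^^ i) x)) \<le> C * direct_sum_norm m nrm ((A ^^ i) x)"
    using assms(3,5) by (intro assms(4) funpow_in_invariant_set[of "direct_sum m" A])
  also have "\<dots> \<le> C * (C ^ i * direct_sum_norm m nrm x)"
    using Suc assms(2) by (rule mult_left_mono)
  finally show ?case
    by (simp add: mult.assoc)
qed simp

text \<open>Coordinatewise, the i-th term of the polynomial contributes at most
  \<open>v (coeff f i) * C ^ i\<close> times the norm of \<open>x\<close>. The bound is crude but
  finite, as the supremum in \<open>op_norm\<close> requires.\<close>

lemma poly_op_direct_sum_bound: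
  assumes "m \<ge> 1" "C \<ge> 0" "\<And>x. x \<in> direct_sum m \<Longrightarrow> A x \<in> direct_sum m"
    and "\<And>x. x \<in> direct_sum m \<Longrightarrow> direct_sum_norm m nrm (A x) \<le> C * direct_sum_norm m nrm x"
    and "x \<in> direct_sum m"
  shows "direct_sum_norm m nrm (poly_op (direct_sum_scale smul) f A x)
    \<le> (\<Sum>i\<le>degree f. v (coeff f i) * C ^ i) * direct_sum_norm m nrm x"
proof (rule direct_sum_norm_le[OF assms(1)])
  fix k
  have "(A ^^ i) x \<in> direct_sum m" for i
    using assms(3,5) by (rule funpow_in_invariant_set[of "direct_sum m" A])
  then have "nrm ((A ^^ i) x k) \<le> C ^ i * direct_sum_norm m nrm x" for i
    by (rule order_trans[OF direct_sum_norm_ge[OF _ assms(1)] funpow_bound[OF assms]])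
  then have "v (coeff f i) * nrm ((A ^^ i) x k)
      \<le> v (coeff f i) * C ^ i * direct_sum_norm m nrm x" for i
    by (simp add: mult.assoc mult_left_mono v_nonneg)
  then have "(\<Sum>i\<le>degree f. nrm (smul (coeff f i) ((A ^^ i) x k)))
      \<le> (\<Sum>i\<le>degree f. v (coeff f i) * C ^ i * direct_sum_norm m nrm x)"
    by (intro sum_mono) (simp add: nrm_scale)
  then show "nrm (poly_op (direct_sum_scale smul) f A x k)
      \<le> (\<Sum>i\<le>degree f. v (coeff f i) * C ^ i) * direct_sum_norm m nrm x"
    unfolding poly_op_direct_sum_apply sum_distrib_right
    by (rule order_trans[OF nrm_sum])
qed

lemma egervary_op_bound:
  assumes "bounded_op smul nrm T" "bounded_op smul nrm S"
    and "bounded_op smul nrm M" "bounded_op smul nrm M'"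
  obtains C where "C \<ge> 0"
    "\<And>x. x \<in> direct_sum (N + 1) \<Longrightarrow>
      direct_sum_norm (N + 1) nrm (egervary_op N T S M M' x) \<le> C * direct_sum_norm (N + 1) nrm x"
proof -
  obtain a where a: "a \<ge> 0" "\<And>x. nrm (T x) \<le> a * nrm x"
    using bounded_op_nonneg_bound[OF assms(1)] by blast
  obtain b where b: "b \<ge> 0" "\<And>x. nrm (S x) \<le> b * nrm x"
    using bounded_op_nonneg_bound[OF assms(2)] by blast
  obtain c where c: "c \<ge> 0" "\<And>x. nrm (M x) \<le> c * nrm x"
    using bounded_op_nonneg_bound[OF assms(3)] by blast
  obtain d where d: "d \<ge> 0" "\<And>x. nrm (M' x) \<le> d * nrm x"
    using bounded_op_nonneg_bound[OF assms(4)] by blast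
  show thesis
  proof
    \<comment> \<open>One constant for every coordinate: \<open>a + d\<close> covers the first,
      \<open>b + c\<close> the second, and \<open>1\<close> the shifted ones.\<close>
    show "a + b + c + d + 1 \<ge> 0"
      using a b c d by simp
    fix x :: "nat \<Rightarrow> 'x"
    assume x: "x \<in> direct_sum (N + 1)"
    define n where "n = direct_sum_norm (N + 1) nrm x"
    have le: "nrm (x k) \<le> n" for k
      unfolding n_def using x by (intro direct_sum_norm_ge) auto
    have n: "n \<ge> 0"
      using le[of 0] nrm_nonneg[of "x 0"] by linarith
    have bounds: "nrm (T (x k)) \<le> a * n" "nrm (S (x k)) \<le> b * n"
      "nrm (M (x k)) \<le> c * n" "nrm (M' (x k)) \<le> d * n" for k
      by (rule order_trans[OF a(2) mult_left_mono[OF le a(1)]],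
          rule order_trans[OF b(2) mult_left_mono[OF le b(1)]],
          rule order_trans[OF c(2) mult_left_mono[OF le c(1)]],
          rule order_trans[OF d(2) mult_left_mono[OF le d(1)]])
    have pos: "0 \<le> a * n" "0 \<le> b * n" "0 \<le> c * n" "0 \<le> d * n"
      using a b c d n by auto
    have "nrm (egervary_op N T S M M' x k) \<le> (a + b + c + d + 1) * n" for k
    proof -
      have "nrm (T (x 1) + M' (x (N + 1))) \<le> a * n + d * n"
        using nrm_triangle[of "T (x 1)" "M' (x (N + 1))"] bounds(1)[of 1] bounds(4)[of "N + 1"]
        by linarith
      moreover have "nrm (M (x 1) - S (x (N + 1))) \<le> c * n + b * n"
        using nrm_triangle_diff[of "M (x 1)" "S (x (N + 1))"] bounds(3)[of 1] bounds(2)[of "N + 1"]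
        by linarith
      ultimately show ?thesis
        using le[of "k - 1"] pos n nrm_0 unfolding egervary_op_def distrib_right by auto
    qed
    then show "direct_sum_norm (N + 1) nrm (egervary_op N T S M M' x)
        \<le> (a + b + c + d + 1) * direct_sum_norm (N + 1) nrm x"
      unfolding n_def by (intro direct_sum_norm_le) auto
  qed
qed

end

context padic_hilbert_space
begin

text \<open>Both candidates pair equally with every vector, so nondegeneracy kills their difference.
  It tests the first argument while the adjoint stands in the second, hence the use of
  \<open>ip_sym\<close>.\<close>

lemma is_adjoint_unique:
  assumes "is_adjoint smul nrm ip T S" "is_adjoint smul nrm ip T S'"
  shows "S = S'"
proof
  fix y
  have "ip (S y - S' y) x = 0" for x
  proof -
    \<comment> \<open>The difference is put into the shape that \<open>ip_linear\<close>
      handles.\<close>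
    have "ip (smul (- 1) (S' y) + S y) x = - ip (S' y) x + ip (S y) x"
      by (simp only: ip_linear) simp
    moreover have "ip (S y) x = ip (S' y) x"
      using assms by (metis is_adjoint_def ip_sym)
    ultimately show ?thesis
      by simp
  qed
  then show "S y = S' y"
    using ip_nondegenerate by force
qed

lemma is_adjoint_adj:
  assumes "adjointable smul nrm ip T"
  shows "is_adjoint smul nrm ip T (adj smul nrm ip T)"
proof -
  obtain S where "is_adjoint smul nrm ip T S"
    using assms by (auto simp: adjointable_def)
  then show ?thesis
    unfolding adj_def by (metis theI is_adjoint_unique)
qed

end

text \<open>The induction needs the support as well as the first coordinate: each application of
  \<open>U\<close> moves the end of the support by at most one slot.\<close>

lemma egervary_op_funpow_single:
  fixes x :: "'x::ab_group_add"
  assumes "N \<ge> 1" "T 0 = 0" "S 0 = 0" "M' 0 = 0"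
    and U: "\<And>x. x \<in> direct_sum (N + 1) \<Longrightarrow> U x = egervary_op N T S M M' x"
    and "i \<le> N"
  defines "y \<equiv> \<lambda>i. (U ^^ i) (\<lambda>k. if k = 1 then x else 0)"
  shows "y i \<in> direct_sum (N + 1) \<and> y i 1 = (T ^^ i) x \<and> (\<forall>k > i + 1. y i k = 0)"
  using \<open>i \<le> N\<close>
proof (induction i)
  case 0
  show ?case
    by (auto simp: y_def direct_sum_def)
next
  case (Suc i)
  then have IH: "y i \<in> direct_sum (N + 1)" "y i 1 = (T ^^ i) x" "\<And>k. k > i + 1 \<Longrightarrow> y i k = 0"
    by auto
  have step: "y (Suc i) = egervary_op N T S M M' (y i)"
    using U[OF IH(1)] by (simp add: y_def)
  \<comment> \<open>Here \<open>Suc i \<le> N\<close>, so slot \<open>N + 1\<close> lies beyond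
    \<open>i + 1\<close>; the term fed into \<open>M'\<close> is thus \<open>0\<close>.\<close>
  have "y i (N + 1) = 0"
    using IH(3) Suc.prems by simp
  then have "y (Suc i) 1 = (T ^^ Suc i) x" "\<forall>k > Suc i + 1. y (Suc i) k = 0"
    using IH assms by (auto simp: step egervary_op_def)
  then show ?case
    using egervary_op_in_direct_sum[OF assms(1)] step by metis
qed

theorem theorem2p8:
  fixes v :: "'k::field \<Rightarrow> real"
    and smul :: "'k \<Rightarrow> 'x::ab_group_add \<Rightarrow> 'x"
    and nrm :: "'x \<Rightarrow> real"
    and ip :: "'x \<Rightarrow> 'x \<Rightarrow> 'k"
    and N :: nat
    and f :: "'k poly"
    and T :: "'x \<Rightarrow> 'x"
    and U :: "(nat \<Rightarrow> 'x) \<Rightarrow> (nat \<Rightarrow> 'x)"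
  assumes "padic_hilbert_space v smul nrm ip"
    and "N \<ge> 1"
    and "degree f = N"
    and "magic_contraction smul nrm ip T"
    and "egervary_dilation smul nrm ip N T U"
  shows "op_norm UNIV nrm (poly_op smul f T)
    \<le> op_norm (direct_sum (N + 1)) (direct_sum_norm (N + 1) nrm) (poly_op (direct_sum_scale smul) f U)"
proof -
  interpret padic_hilbert_space v smul nrm ip by fact
  let ?m = "N + 1" and ?S = "adj smul nrm ip T"
  let ?n = "direct_sum_norm ?m nrm" and ?fU = "poly_op (direct_sum_scale smul) f U"
  let ?ratio = "\<lambda>y. ?n (?fU y) / ?n y"
  obtain M M' where M: "magic_pair smul nrm ip T M M'"
    and U: "\<And>x. x \<in> direct_sum ?m \<Longrightarrow> U x = egervary_op N T ?S M M' x"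
    using assms(5) by (auto simp: egervary_dilation_def)
  have bounded: "bounded_op smul nrm T" "bounded_op smul nrm ?S"
    "bounded_op smul nrm M" "bounded_op smul nrm M'"
    using assms(4) M is_adjoint_adj[of T]
    by (auto simp: magic_contraction_def magic_pair_def self_adjoint_def adjointable_def
        is_adjoint_def)
  then have zero: "T 0 = 0" "?S 0 = 0" "M' 0 = 0"
    by (auto intro: bounded_op_0)
  obtain C where C: "C \<ge> 0" "\<And>x. x \<in> direct_sum ?m \<Longrightarrow> ?n (egervary_op N T ?S M M' x) \<le> C * ?n x"
    using egervary_op_bound[OF bounded] by blast
  \<comment> \<open>\<open>U\<close> is prescribed only on the direct sum, so its iterates must be
    kept there.\<close>
  have inv: "U x \<in> direct_sum ?m" if "x \<in> direct_sum ?m" for x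
    using U[OF that] egervary_op_in_direct_sum[OF assms(2)] by metis
  define D where "D = (\<Sum>i\<le>degree f. v (coeff f i) * C ^ i)"
  have D: "?n (?fU x) \<le> D * ?n x" if "x \<in> direct_sum ?m" for x
    unfolding D_def using C U inv that by (intro poly_op_direct_sum_bound) auto
  have "D \<ge> 0"
    using C(1) by (auto simp: D_def v_nonneg intro!: sum_nonneg)
  have "bdd_above (?ratio ` direct_sum ?m)"
  proof (rule bdd_aboveI2)
    fix x :: "nat \<Rightarrow> 'x"
    assume x: "x \<in> direct_sum ?m"
    show "?ratio x \<le> D"
      \<comment> \<open>At norm \<open>0\<close> the quotient is \<open>0\<close> by convention,
        which is where \<open>D \<ge> 0\<close> enters.\<close>
      using D[OF x] direct_sum_norm_nonneg[OF x] \<open>D \<ge> 0\<close>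
      by (cases "?n x = 0") (auto simp: divide_le_eq)
  qed
  moreover have "\<exists>y\<in>direct_sum ?m. nrm (poly_op smul f T x) / nrm x \<le> ?ratio y" for x
  proof
    define y where "y = (\<lambda>k::nat. if k = 1 then x else 0)"
    show y: "y \<in> direct_sum ?m"
      by (auto simp: y_def direct_sum_def)
    have "(U ^^ i) y 1 = (T ^^ i) x" if "i \<le> N" for i
      using egervary_op_funpow_single[where U = U, OF assms(2) zero U that]
      unfolding y_def by blast
    then have "?fU y 1 = poly_op smul f T x"
      using assms(3) unfolding poly_op_direct_sum_apply unfolding poly_op_def
      by (intro sum.cong) auto
    moreover have "nrm (?fU y 1) \<le> ?n (?fU y)"
      unfolding direct_sum_norm_def by (intro Max_ge) auto
    moreover have "?n y = nrm x"
      unfolding y_def by (rule direct_sum_norm_single) simp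
    \<comment> \<open>The denominators agree, so comparing numerators suffices; for
      \<open>x = 0\<close> both quotients are \<open>0\<close>.\<close>
    ultimately show "nrm (poly_op smul f T x) / nrm x \<le> ?ratio y"
      by (simp add: divide_right_mono nrm_nonneg)
  qed
  ultimately show ?thesis
    unfolding op_norm_def by (intro cSUP_mono) auto
qed

end
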